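(* Let $w$ be a double palindromic periodicity with parameters $(r_1,h_1)$ and $(r_2,h_2)$; that is, $w$ is a palindromic periodicity with offset $r_1$ and half-period $h_1$, and also a palindromic periodicity with offset $r_2$ and half-period $h_2$. If $$|w|\ge 2h_1+2h_2-\gcd(2(r_2-r_1),2h_1,2h_2),$$ then $w$ has period $\gcd(2(r_2-r_1),2h_1,2h_2)$.
   Context: Words are finite sequences of letters $w=w[1]w[2]\cdots w[n]$, and $|w|=n$. A word is a palindrome if it equals its reverse; the empty word is a palindrome. A word $w$ has period $q$ if $w[j]=w[j+q]$ whenever both positions are in $w$. For a nonempty word $x$, $x^\omega=xxx\cdots$. A palindromic periodicity is a factor, of length at least $|ps|\ge 1$, of an infinite word $(ps)^\omega$ where $p$ and $s$ are palindromes (either may be empty). Every palindromic periodicity is a prefix of such an infinite word; if $w$ is a prefix of $(ps)^\omega$ with $p,s$ palindromes and $|w|\ge |ps|$, then $w$ is a palindromic periodicity with half-period $h=|ps|/2$ and offset $r=(|p|+1)/2$, the position of the centre of the initial $p$. The positions $r, r+h, r+2h,\dots$ are its essential palindromic centres (the centres of the successive occurrences of $p$ and $s$). Offsets and half-periods are integers or integers plus $1/2$, so $2h_1$, $2h_2$ and $2(r_2-r_1)$ are integers; the gcd is the nonnegative one, with signs disregarded and $\gcd(0,a,b)=\gcd(a,b)$. *)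

theory Defs
  imports Complex_Main "HOL-Library.Stream"
begin

text \<open>
  Words are lists. List positions start at 0 whereas the positions of the mathematical text
  start at 1; offsets (see below) keep the 1-based convention.
\<close>

definition palindrome :: "'a list \<Rightarrow> bool" where
  "palindrome w \<longleftrightarrow> rev w = w"

text \<open>Periods are positive: 0 would vacuously be a period of every word.\<close>

definition has_period :: "'a list \<Rightarrow> nat \<Rightarrow> bool" where
  "has_period w q \<longleftrightarrow> 0 < q \<and> (\<forall>j. j + q < length w \<longrightarrow> w ! j = w ! (j + q))"

text \<open>
  For a nonempty word \<open>x\<close>, the infinite word \<open>x\<^sup>\<omega>\<close> is the stream \<open>cycle x\<close>. The
  library leaves \<open>cycle []\<close> unspecified, so \<open>p @ s \<noteq> []\<close> is always required below.
\<close>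

definition stream_prefix :: "'a list \<Rightarrow> 'a stream \<Rightarrow> bool" where
  "stream_prefix w x \<longleftrightarrow> stake (length w) x = w"

definition stream_factor :: "'a list \<Rightarrow> 'a stream \<Rightarrow> bool" where
  "stream_factor w x \<longleftrightarrow> (\<exists>k. stream_prefix w (sdrop k x))"

definition palindromic_periodicity :: "'a list \<Rightarrow> bool" where
  "palindromic_periodicity w \<longleftrightarrow>
     (\<exists>p s. palindrome p \<and> palindrome s \<and> p @ s \<noteq> [] \<and> length w \<ge> length (p @ s) \<and>
            stream_factor w (cycle (p @ s)))"

text \<open>
  The offset \<open>r\<close> and the half-period \<open>h\<close> are integers or integers plus one half. In 1-based
  positions, \<open>r\<close> is the centre of the initial \<open>p\<close>; it is \<open>1/2\<close> when \<open>p\<close> is empty.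
\<close>

definition palindromic_periodicity_with :: "'a list \<Rightarrow> rat \<Rightarrow> rat \<Rightarrow> bool" where
  "palindromic_periodicity_with w r h \<longleftrightarrow>
     (\<exists>p s. palindrome p \<and> palindrome s \<and> p @ s \<noteq> [] \<and> length w \<ge> length (p @ s) \<and>
            stream_prefix w (cycle (p @ s)) \<and>
            h = of_nat (length (p @ s)) / 2 \<and> r = (of_nat (length p) + 1) / 2)"

lemma palindromic_periodicity_with_imp:
  "palindromic_periodicity_with w r h \<Longrightarrow> palindromic_periodicity w"
proof -
  have "stream_factor w x" if "stream_prefix w x" for x
    unfolding stream_factor_def by (rule exI[of _ 0]) (simp add: that)
  then show "palindromic_periodicity_with w r h \<Longrightarrow> palindromic_periodicity w"
    unfolding palindromic_periodicity_with_def palindromic_periodicity_def by blast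
qed

definition double_palindromic_periodicity ::
    "'a list \<Rightarrow> rat \<Rightarrow> rat \<Rightarrow> rat \<Rightarrow> rat \<Rightarrow> bool" where
  "double_palindromic_periodicity w r1 h1 r2 h2 \<longleftrightarrow>
     palindromic_periodicity_with w r1 h1 \<and> palindromic_periodicity_with w r2 h2"

text \<open>
  The number \<open>gcd(2(r2 - r1), 2 h1, 2 h2)\<close>. The floors only convert the type: all three
  arguments are integers for the parameters of a double palindromic periodicity, as the lemma
  below records. The library \<open>gcd\<close> on \<^typ>\<open>int\<close> is nonnegative and disregards signs.
\<close>

definition param_gcd :: "rat \<Rightarrow> rat \<Rightarrow> rat \<Rightarrow> rat \<Rightarrow> nat" where
  "param_gcd r1 h1 r2 h2 =
     nat (gcd \<lfloor>2 * (r2 - r1)\<rfloor> (gcd \<lfloor>2 * h1\<rfloor> \<lfloor>2 * h2\<rfloor>))"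

lemma double_palindromic_periodicity_floors:
  assumes "double_palindromic_periodicity w r1 h1 r2 h2"
  shows "of_int \<lfloor>2 * (r2 - r1)\<rfloor> = 2 * (r2 - r1)"
    and "of_int \<lfloor>2 * h1\<rfloor> = 2 * h1"
    and "of_int \<lfloor>2 * h2\<rfloor> = 2 * h2"
proof -
  have half: "\<exists>a m :: nat. 2 * h = of_nat a \<and> 2 * r = of_nat m + 1"
    if "palindromic_periodicity_with w r h" for r h
  proof -
    from that obtain p s :: "'a list" where
      "h = of_nat (length (p @ s)) / 2" "r = (of_nat (length p) + 1) / 2"
      unfolding palindromic_periodicity_with_def by blast
    then have "2 * h = of_nat (length (p @ s)) \<and> 2 * r = of_nat (length p) + 1"
      by simp
    then show ?thesis by blast
  qed
  have "palindromic_periodicity_with w r1 h1" "palindromic_periodicity_with w r2 h2"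
    using assms by (simp_all add: double_palindromic_periodicity_def)
  from this[THEN half] obtain a b m n :: nat where
    *: "2 * h1 = of_nat a" "2 * h2 = of_nat b"
       "2 * r1 = of_nat m + 1" "2 * r2 = of_nat n + 1"
    by (elim exE conjE)
  have "2 * (r2 - r1) = of_int (int n - int m)"
    using * by (simp add: algebra_simps)
  then show "of_int \<lfloor>2 * (r2 - r1)\<rfloor> = 2 * (r2 - r1)"
    by (metis floor_of_int)
  show "of_int \<lfloor>2 * h1\<rfloor> = 2 * h1" "of_int \<lfloor>2 * h2\<rfloor> = 2 * h2"
    using * by simp_all
qed

end

theory Submission
  imports Defs
begin

text \<open>
  Let \<open>a = 2 h\<^sub>1\<close> and \<open>b = 2 h\<^sub>2\<close>, and let \<open>p\<close>, \<open>q\<close> be the initial palindromes of the two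
  periodicities. A word that is a prefix of \<open>(ps)\<^sup>\<omega>\<close> has the period \<open>a = \<bar>ps\<bar>\<close> and, because
  \<open>p\<close> and \<open>s\<close> are palindromes, it is invariant under the reflections
  \<open>i \<mapsto> \<bar>p\<bar> - 1 - i\<close> taken modulo \<open>a\<close> (0-based positions).

  The number \<open>d = gcd(2(r\<^sub>2 - r\<^sub>1), a, b)\<close> divides \<open>g = gcd(a, b)\<close>, so the length bound with \<open>d\<close>
  implies the bound \<open>\<bar>w\<bar> \<ge> a + b - g\<close> of the Fine--Wilf theorem, and \<open>w\<close> has the period \<open>g\<close>.
  Since \<open>\<bar>w\<bar> \<ge> a \<ge> g\<close>, the word extends to a two-sided infinite word \<open>V\<close> with period \<open>g\<close>. As
  \<open>w\<close> contains a full period \<open>a\<close> and a full period \<open>b\<close>, both families of reflections pass to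
  \<open>V\<close>, where no boundary obstructs them. The composition of the two reflections is the translation
  by \<open>\<bar>p\<bar> - \<bar>q\<bar> = 2(r\<^sub>1 - r\<^sub>2)\<close>, so \<open>V\<close> has the periods \<open>g\<close> and \<open>2(r\<^sub>1 - r\<^sub>2)\<close>, and hence,
  by Bezout's identity, the period \<open>d\<close>.
\<close>

section \<open>Periods and the Fine--Wilf theorem\<close>

lemma has_period_nth_mod:
  assumes "has_period w q" "i < length w"
  shows "w ! i = w ! (i mod q)"
  using assms(2)
proof (induction i rule: less_induct)
  case (less i)
  have q: "0 < q" using assms(1) by (simp add: has_period_def)
  show ?case
  proof (cases "i < q")
    case False
    have "w ! (i - q) = w ! (i - q + q)"
      using assms(1) less.prems False unfolding has_period_def
      by (metis le_add_diff_inverse2 not_less)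
    moreover have "w ! (i - q) = w ! ((i - q) mod q)"
      using less q False by simp
    ultimately show ?thesis using False by (simp add: le_mod_geq)
  qed simp
qed

text \<open>
  A position is first reduced modulo \<open>a\<close>, which brings it into the prefix, and then modulo \<open>g\<close>
  inside the prefix. As \<open>g\<close> divides \<open>a\<close>, the result is the residue of the position modulo \<open>g\<close>.
\<close>

lemma has_period_if_take_has_period:
  assumes "has_period (take m w) g" "has_period w a" "g dvd a" "a \<le> m"
  shows "has_period w g"
  unfolding has_period_def
proof (intro conjI allI impI)
  show "0 < g" using assms(1) by (simp add: has_period_def)
  fix j assume j: "j + g < length w"
  have red: "w ! i = w ! (i mod g)" if i: "i < length w" for i
  proof -
    have a: "0 < a" using assms(2) by (simp add: has_period_def)
    have ia: "i mod a < length (take m w)"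
      using a assms(4) i by (metis length_take le_less_trans min_less_iff_conj mod_less_divisor
          mod_less_eq_dividend order_less_le_trans)
    have "w ! i = w ! (i mod a)"
      using has_period_nth_mod[OF assms(2) i] .
    also have "\<dots> = take m w ! (i mod a)"
      using ia by simp
    also have "\<dots> = take m w ! (i mod a mod g)"
      using has_period_nth_mod[OF assms(1) ia] .
    also have "i mod a mod g = i mod g"
      using assms(3) by (rule mod_mod_cancel)
    also have "take m w ! (i mod g) = w ! (i mod g)"
    proof -
      have "i mod g \<le> i mod a"
        by (metis assms(3) mod_less_eq_dividend mod_mod_cancel)
      then show ?thesis using ia by simp
    qed
    finally show ?thesis .
  qed
  show "w ! j = w ! (j + g)"
    using red[of j] red[of "j + g"] j by simp
qed

text \<open>
  The induction follows Euclid's subtractive algorithm: if \<open>a < b\<close> then the prefix obtained by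
  dropping the last \<open>a\<close> letters has the periods \<open>a\<close> and \<open>b - a\<close>, and it still satisfies the
  length bound for them. This prefix is at least \<open>a\<close> letters long because \<open>gcd a b\<close> divides
  \<open>b - a\<close>, so its period is inherited by the whole word.
\<close>

theorem Fine_Wilf:
  assumes "has_period w a" "has_period w b" "a + b \<le> length w + gcd a b"
  shows "has_period w (gcd a b)"
  using assms
proof (induction "a + b" arbitrary: a b w rule: less_induct)
  case less
  have step: "has_period u (gcd x y)"
    if xy: "x < y" "x + y = a + b" and ux: "has_period u x" and uy: "has_period u y"
      and len: "x + y \<le> length u + gcd x y" for x y and u :: "'a list"
  proof -
    have x: "0 < x" using ux by (simp add: has_period_def)
    have g: "gcd x (y - x) = gcd x y"
      using xy(1) by (metis gcd.commute gcd_diff1_nat less_imp_le)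
    have gle: "gcd x y \<le> y - x"
      using g xy(1) by (metis gcd_le2_nat not_gr_zero zero_less_diff)
    let ?v = "take (length u - x) u"
    have v: "length ?v = length u - x" by simp
    have "has_period ?v x"
      using ux by (auto simp: has_period_def)
    moreover have "has_period ?v (y - x)"
      unfolding has_period_def
    proof (intro conjI allI impI)
      show "0 < y - x" using xy(1) by simp
      fix j assume j: "j + (y - x) < length ?v"
      have "u ! j = u ! (j + y)"
        using uy j xy(1) by (simp add: has_period_def)
      moreover have "u ! (j + (y - x)) = u ! (j + (y - x) + x)"
        using ux j by (simp add: has_period_def)
      ultimately show "?v ! j = ?v ! (j + (y - x))"
        using j xy(1) by simp
    qed
    moreover have "x + (y - x) \<le> length ?v + gcd x (y - x)"
      using len xy(1) g v by linarith
    moreover have "x + (y - x) < a + b" using xy x by linarith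
    ultimately have "has_period ?v (gcd x y)"
      using less.hyps g by metis
    moreover have "x \<le> length u - x"
      using len gle xy(1) by linarith
    ultimately show ?thesis
      using ux by (blast intro: has_period_if_take_has_period)
  qed
  consider "a < b" | "b < a" | "a = b" by linarith
  then show ?case
  proof cases
    case 1 then show ?thesis using step[of a b w] less.prems by simp
  next
    case 2 then show ?thesis using step[of b a w] less.prems by (simp add: gcd.commute add.commute)
  next
    case 3 then show ?thesis using less.prems by simp
  qed
qed

section \<open>Reflections of palindromic periodicities\<close>

lemma palindrome_nth_eq:
  assumes "palindrome p" "i + j + 1 = length p"
  shows "p ! i = p ! j"
proof -
  have "i < length p" and j: "length p - Suc i = j" using assms(2) by auto
  then show ?thesis using rev_nth[of i p] assms(1) by (simp add: palindrome_def)
qed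

lemma nth_stream_prefix_cycle:
  assumes "stream_prefix w (cycle u)" "u \<noteq> []" "i < length w"
  shows "w ! i = u ! (i mod length u)"
proof -
  have "w ! i = cycle u !! i"
    using assms(1,3) unfolding stream_prefix_def by (metis stake_nth)
  also have "\<dots> = shd (sdrop i (cycle u))" by simp
  also have "\<dots> = hd (rotate (i mod length u) u)"
    by (simp only: sdrop_cycle[OF assms(2)] cycle.sel)
  also have "\<dots> = u ! (i mod length u)" using assms(2) by (simp add: hd_rotate_conv_nth)
  finally show ?thesis .
qed

lemma has_period_if_stream_prefix_cycle:
  assumes "stream_prefix w (cycle u)" "u \<noteq> []"
  shows "has_period w (length u)"
  unfolding has_period_def
  using assms by (auto simp: nth_stream_prefix_cycle)

text \<open>
  A single congruence covers the reflections about all essential centres. After reduction to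
  residues \<open>i, j < \<bar>ps\<bar>\<close> it leaves only \<open>i + j + 1 = \<bar>p\<bar>\<close>, which is the symmetry of \<open>p\<close>,
  and \<open>i + j + 1 = \<bar>p\<bar> + \<bar>ps\<bar>\<close>, which is the symmetry of \<open>s\<close>.
\<close>

lemma palindromic_periodicity_reflect:
  assumes "palindrome p" "palindrome s" "p @ s \<noteq> []" "stream_prefix w (cycle (p @ s))"
    and ij: "i < length w" "j < length w"
    and cong: "int (length (p @ s)) dvd int i + int j + 1 - int (length p)"
  shows "w ! i = w ! j"
proof -
  define a where "a = length (p @ s)"
  define k where "k = i mod a"
  define l where "l = j mod a"
  have a: "0 < a" using assms(3) unfolding a_def by (metis length_greater_0_conv)
  have kl: "k < a" "l < a" using a by (simp_all add: k_def l_def)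
  have "(int k + int l + 1 - int (length p)) mod int a = (int i + int j + 1 - int (length p)) mod int a"
    unfolding k_def l_def zmod_int by (intro mod_diff_cong mod_add_cong) simp_all
  then have "int a dvd int k + int l + 1 - int (length p)"
    using cong by (simp add: dvd_eq_mod_eq_0 a_def)
  then obtain m where m: "int k + int l + 1 - int (length p) = int a * m" ..
  have pa: "length p \<le> a" "length s = a - length p" by (simp_all add: a_def)
  have "int a * (-1) < int a * m" using m a pa(1) by simp
  then have "-1 < m" using a by (simp only: mult_less_cancel_left_pos of_nat_0_less_iff)
  moreover have "int a * m < int a * 2" using m kl by linarith
  then have "m < 2" using a by (simp only: mult_less_cancel_left_pos of_nat_0_less_iff)
  ultimately consider "m = 0" | "m = 1" by linarith
  then have "(p @ s) ! k = (p @ s) ! l"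
  proof cases
    case 1
    then have "k + l + 1 = length p" using m by simp
    then show ?thesis using palindrome_nth_eq[OF assms(1)] by (simp add: nth_append)
  next
    case 2
    then have e: "k + l + 1 = length p + a" using m by simp
    then have "\<not> k < length p" "\<not> l < length p" using kl by simp_all
    moreover from this have "(k - length p) + (l - length p) + 1 = length s"
      using e pa by linarith
    ultimately show ?thesis using palindrome_nth_eq[OF assms(2)] by (simp add: nth_append)
  qed
  then show ?thesis
    using nth_stream_prefix_cycle[OF assms(4,3)] ij by (simp add: k_def l_def a_def)
qed

section \<open>Two-sided periodic extensions\<close>

text \<open>
  In the two-sided extension of \<open>w\<close> with period \<open>g\<close>, a reflection known only within \<open>w\<close> becomes
  a global one: \<open>z\<close> and \<open>c - z\<close> have representatives modulo \<open>a\<close> inside \<open>w\<close>, and the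
  extension does not distinguish positions congruent modulo \<open>a\<close>, because \<open>g\<close> divides \<open>a\<close>.
\<close>

lemma reflect_periodic_extension:
  fixes c z :: int
  assumes per: "has_period w g" and "g dvd a" "0 < a" "a \<le> length w"
    and refl: "\<And>i j. i < length w \<Longrightarrow> j < length w \<Longrightarrow> int a dvd int i + int j - c \<Longrightarrow> w ! i = w ! j"
  shows "w ! nat ((c - z) mod int g) = w ! nat (z mod int g)"
proof -
  have ext: "w ! nat (x mod int g) = w ! nat (x mod int a)"
    and bnd: "nat (x mod int a) < length w" for x
  proof -
    have "0 \<le> x mod int a" "x mod int a < int a" using assms(3) by simp_all
    then show b: "nat (x mod int a) < length w"
      using assms(4) by (simp add: nat_less_iff)
    have "nat (x mod int a) mod g = nat (x mod int a mod int g)"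
      using assms(3) by (simp add: nat_mod_distrib)
    also have "\<dots> = nat (x mod int g)"
      using assms(2) by (simp add: mod_mod_cancel)
    finally show "w ! nat (x mod int g) = w ! nat (x mod int a)"
      using has_period_nth_mod[OF per b] by simp
  qed
  have "((c - z) mod int a + z mod int a - c) mod int a = (c - z + z - c) mod int a"
    by (intro mod_diff_cong mod_add_cong) simp_all
  then have "w ! nat ((c - z) mod int a) = w ! nat (z mod int a)"
    using refl[OF bnd bnd] assms(3) by (simp add: dvd_eq_mod_eq_0)
  then show ?thesis by (simp only: ext)
qed

lemma period_gcd_int:
  fixes V :: "int \<Rightarrow> 'a"
  assumes s: "\<And>z. V (z + s) = V z" and t: "\<And>z. V (z + t) = V z"
  shows "V (z + gcd s t) = V z"
proof -
  have mult: "V (z + k * q) = V z" if q: "\<And>z. V (z + q) = V z" for z k q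
  proof (induction k rule: int_induct[of _ 0])
    case (step1 i)
    then show ?case using q[of "z + i * q"] by (simp add: algebra_simps)
  next
    case (step2 i)
    then show ?case using q[of "z + (i - 1) * q"] by (simp add: algebra_simps)
  qed simp
  obtain u v where "u * s + v * t = gcd s t" using bezout_int by blast
  then have "V (z + gcd s t) = V (z + u * s + v * t)" by (simp add: add.assoc)
  then show ?thesis by (simp add: mult[OF s] mult[OF t])
qed

section \<open>Double palindromic periodicities\<close>

theorem theorem3p4:
  fixes w :: "'a list" and r1 h1 r2 h2 :: rat
  assumes "double_palindromic_periodicity w r1 h1 r2 h2"
    and "of_nat (length w) \<ge> 2 * h1 + 2 * h2 - of_nat (param_gcd r1 h1 r2 h2)"
  shows "has_period w (param_gcd r1 h1 r2 h2)"
proof -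
  obtain p s where ps: "palindrome p" "palindrome s" "p @ s \<noteq> []" "length w \<ge> length (p @ s)"
      "stream_prefix w (cycle (p @ s))"
    and h1: "h1 = of_nat (length (p @ s)) / 2" and r1: "r1 = (of_nat (length p) + 1) / 2"
    using assms(1) unfolding double_palindromic_periodicity_def palindromic_periodicity_with_def
    by blast
  obtain q t where qt: "palindrome q" "palindrome t" "q @ t \<noteq> []" "length w \<ge> length (q @ t)"
      "stream_prefix w (cycle (q @ t))"
    and h2: "h2 = of_nat (length (q @ t)) / 2" and r2: "r2 = (of_nat (length q) + 1) / 2"
    using assms(1) unfolding double_palindromic_periodicity_def palindromic_periodicity_with_def
    by blast
  define a where "a = length (p @ s)"
  define b where "b = length (q @ t)"
  define e where "e = int (length q) - int (length p)"
  define d where "d = param_gcd r1 h1 r2 h2"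
  define g where "g = gcd a b"
  have a: "0 < a" and b: "0 < b"
    using ps(3) qt(3) unfolding a_def b_def by (metis length_greater_0_conv)+
  have "2 * (r2 - r1) = of_int e"
    by (simp add: r1 r2 e_def field_simps)
  moreover have h: "2 * h1 = of_nat a" "2 * h2 = of_nat b"
    by (simp_all add: h1 h2 a_def b_def)
  ultimately have "d = nat (gcd e (gcd (int a) (int b)))"
    by (simp add: d_def param_gcd_def)
  then have d: "int d = gcd e (int g)"
    by (simp add: g_def)
  have g: "0 < g" using a by (simp add: g_def)
  have "d \<le> g"
    using d g by (metis gcd_le2_int of_nat_0_less_iff of_nat_le_iff)
  moreover have "a + b \<le> length w + d"
  proof -
    have "(of_nat (a + b) :: rat) \<le> of_nat (length w + d)"
      using assms(2) by (simp add: h d_def)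
    then show ?thesis by (simp only: of_nat_le_iff)
  qed
  ultimately have "a + b \<le> length w + gcd a b" by (simp add: g_def)
  then have per: "has_period w g"
    unfolding g_def using Fine_Wilf has_period_if_stream_prefix_cycle ps(3,5) qt(3,5)
    by (metis a_def b_def)
  define V where "V z = w ! nat (z mod int g)" for z
  have "V (int (length p) - 1 - z) = V z" for z
    unfolding V_def
  proof (rule reflect_periodic_extension[OF per, of a])
    show "w ! i = w ! j"
      if "i < length w" "j < length w" "int a dvd int i + int j - (int (length p) - 1)" for i j
      using palindromic_periodicity_reflect[OF ps(1,2,3,5) that(1,2)] that(3)
      by (simp add: a_def algebra_simps)
  qed (use a ps(4) in \<open>simp_all add: g_def a_def\<close>)
  moreover have "V (int (length q) - 1 - z) = V z" for z
    unfolding V_def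
  proof (rule reflect_periodic_extension[OF per, of b])
    show "w ! i = w ! j"
      if "i < length w" "j < length w" "int b dvd int i + int j - (int (length q) - 1)" for i j
      using palindromic_periodicity_reflect[OF qt(1,2,3,5) that(1,2)] that(3)
      by (simp add: b_def algebra_simps)
  qed (use b qt(4) in \<open>simp_all add: g_def b_def\<close>)
  ultimately have "V (z + e) = V z" for z
  proof -
    \<comment> \<open>two successive reflections compose to a translation\<close>
    have "V (z + e) = V (int (length q) - 1 - (int (length p) - 1 - z))"
      by (simp add: e_def algebra_simps)
    also have "\<dots> = V (int (length p) - 1 - z)" by fact
    also have "\<dots> = V z" by fact
    finally show ?thesis .
  qed
  moreover have "V (z + int g) = V z" for z by (simp add: V_def)
  ultimately have V: "V (z + int d) = V z" for z
    using period_gcd_int[of V] d by simp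
  have w: "w ! i = V (int i)" if "i < length w" for i
    using has_period_nth_mod[OF per that] by (simp add: V_def flip: zmod_int)
  have "0 < d" using d g by (metis gcd_pos_int of_nat_0_less_iff not_gr_zero of_nat_0)
  moreover have "w ! j = w ! (j + d)" if "j + d < length w" for j
    using w[of j] w[of "j + d"] V[of "int j"] that by simp
  ultimately show ?thesis
    unfolding has_period_def d_def by blast
qed

end
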